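(* For a single block, let $\tilde{\boldsymbol{u}},\dot{\tilde{\boldsymbol{u}}}$ be grid functions and $\boldsymbol{u}^{*f}$ ($f=1,\dots,2d$) face grid functions, and define the block energy $$\mathcal{E}^B=\frac12\dot{\tilde{\boldsymbol{u}}}^T\tilde{\boldsymbol{H}}\tilde{\boldsymbol{\rho}}\,\dot{\tilde{\boldsymbol{u}}}+\frac12\sum_{i,j=1}^d\tilde{\boldsymbol{u}}^T\tilde{\boldsymbol{A}}_{ij}^{(\hat C_{ij})}\tilde{\boldsymbol{u}}+\frac12\sum_{f=1}^{2d}\Big((\hat{\boldsymbol{\tau}}^f)^T(\boldsymbol{X}^f)^{-1}\boldsymbol{H}^f\hat{\boldsymbol{\tau}}^f-(\hat{\boldsymbol{T}}^f)^T(\boldsymbol{X}^f)^{-1}\boldsymbol{H}^f\hat{\boldsymbol{T}}^f\Big),$$ where $$\hat{\boldsymbol{T}}^f=\sum_{i,j}\hat n_i^f\hat{\boldsymbol{C}}_{ij}^f\bar{\boldsymbol{B}}_j^f\tilde{\boldsymbol{u}},\qquad \hat{\boldsymbol{\tau}}^f=\hat{\boldsymbol{T}}^f+\boldsymbol{X}^f\big(\boldsymbol{u}^{*f}-\bar{\boldsymbol{L}}^f\tilde{\boldsymbol{u}}\big),\qquad \boldsymbol{X}^f=\sum_{i,j}\hat n_i^f\hat n_j^f\hat{\boldsymbol{C}}_{ij}^f\boldsymbol{\Gamma}^f,$$ and $\boldsymbol{\Gamma}^f$ is a diagonal matrix of penalty parameters. If the $\boldsymbol{\Gamma}^f$ are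 positive and sufficiently large (i.e. there is a threshold, independent of $\tilde{\boldsymbol{u}},\dot{\tilde{\boldsymbol{u}}},\boldsymbol{u}^{*f}$, such that all diagonal entries of all $\boldsymbol{\Gamma}^f$ exceed it), then $\mathcal{E}^B$ is a seminorm of the solution, in the sense that the quadratic form $\mathcal{E}^B$ is nonnegative for all $\tilde{\boldsymbol{u}},\dot{\tilde{\boldsymbol{u}}},\boldsymbol{u}^{*f}$.
   Context: One-dimensional operators on grid points $0,\dots,N$ ($N\ge1$, spacing $h=1/N$; $\boldsymbol{e}_k$ the $k$-th grid basis vector): $\boldsymbol{H}$ is diagonal positive definite; the first derivative operator $\boldsymbol{D}_1=\boldsymbol{H}^{-1}\boldsymbol{Q}$ satisfies $\boldsymbol{Q}+\boldsymbol{Q}^T=\boldsymbol{e}_N\boldsymbol{e}_N^T-\boldsymbol{e}_0\boldsymbol{e}_0^T$; $\boldsymbol{b}_0,\boldsymbol{b}_N$ are boundary derivative vectors (not assumed to come from rows of $\boldsymbol{D}_1$). For each positive coefficient grid function $C$ (written as a diagonal matrix $\boldsymbol{C}$) there is a symmetric positive semidefinite matrix $\boldsymbol{A}_{11}^{(C)}$ with $\boldsymbol{H}\boldsymbol{D}_{11}^{(C)}=-\boldsymbol{A}_{11}^{(C)}+C_N\boldsymbol{e}_N\boldsymbol{b}_N^T-C_0\boldsymbol{e}_0\boldsymbol{b}_0^T$, $\boldsymbol{D}_{11}^{(C)}$ being the SBP approximation of $\partial_1 C\partial_1$. Known property of the variable-coefficient operators used (Mattsson 2012; borrowing lemma of Almquist–Dunham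 2020): $$\boldsymbol{A}_{11}^{(C)}=\boldsymbol{D}_1^T\boldsymbol{C}\boldsymbol{H}\boldsymbol{D}_1+\boldsymbol{S}^{(C)}+\zeta\sum_{k\in\{0,N\}}C_k^{\min}\boldsymbol{\Delta}_k\boldsymbol{\Delta}_k^T,\qquad \boldsymbol{\Delta}_k^T=\boldsymbol{b}_k^T-\boldsymbol{e}_k^T\boldsymbol{D}_1,$$ with $\boldsymbol{S}^{(C)}$ positive semidefinite, $\zeta>0$ depending only on the operator (it equals $h$ times a constant), and $C_k^{\min}$ the minimum of $C$ over the $m_b$ grid points nearest endpoint $k$ ($m_b$ fixed by the operator). Multidimensional operators on $[0,1]^d$ with a tensor product grid ($N_i+1$ points in direction $i$): $\tilde{\boldsymbol{H}}$ is the tensor product of the one-dimensional $\boldsymbol{H}$'s; $\tilde{\boldsymbol{D}}_i$ applies $\boldsymbol{D}_1$ along direction $i$. Faces $f=1,\dots,2d$: faces $2i-1$ and $2i$ are $\xi_i=0$ and $\xi_i=1$; $\hat n_i^f=(-1)^f$ if $i=\lceil f/2\rceil$ and $0$ otherwise. $\bar{\boldsymbol{L}}^f$ restricts a grid function to face $f$; $\boldsymbol{H}^f$ is the diagonal tensor product of the one-dimensional $\boldsymbol{H}$'s of the directions tangential to face $f$. $\bar{\boldsymbol{B}}_j^f$: if $j=\lceil f/2\rceil$, apply $\boldsymbol{b}_0^T$ ($f$ odd) or $\boldsymbol{b}_N^T$ ($f$ even) along direction $j$; if $j\neq\lceil f/2\rceil$, $\bar{\boldsymbol{B}}_j^f=\bar{\boldsymbol{L}}^f\tilde{\boldsymbol{D}}_j$.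 For a coefficient grid function $C$ with diagonal matrix $\tilde{\boldsymbol{C}}$: for $i\ne j$, $\tilde{\boldsymbol{A}}_{ij}^{(C)}=\tilde{\boldsymbol{D}}_i^T\tilde{\boldsymbol{C}}\tilde{\boldsymbol{H}}\tilde{\boldsymbol{D}}_j$; for $i=j$, $\tilde{\boldsymbol{A}}_{ii}^{(C)}$ is the sum over all grid lines in direction $i$ of $\boldsymbol{A}_{11}^{(C\text{ on the line})}$ acting on that line, weighted by the product of the diagonal $\boldsymbol{H}$ entries of the other directions. Coefficients: at every grid point the matrix $(\hat C_{ij})_{i,j=1}^d$ is symmetric positive definite; $\hat{\boldsymbol{C}}_{ij}^f$ is the diagonal matrix of values of $\hat C_{ij}$ at the points of face $f$; $\tilde{\boldsymbol{\rho}}$ is the diagonal matrix of (positive) density values at the grid points. *)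

theory Defs
  imports Complex_Main "HOL-Library.FuncSet" "HOL-Library.Function_Algebras"
begin

text \<open>
  The number of grid points differs from direction to direction and the points of the
  multidimensional grid are multi-indices, so vectors and matrices are functions on an index type,
  and every operation carries the finite index set it ranges over.  Sums and differences of
  vectors and matrices are pointwise (\<^theory>\<open>HOL-Library.Function_Algebras\<close>).
\<close>

type_synonym 'a rvec = "'a \<Rightarrow> real"
type_synonym ('a, 'b) rmat = "'a \<Rightarrow> 'b \<Rightarrow> real"

definition mat_mul :: "('a, 'b) rmat \<Rightarrow> 'b set \<Rightarrow> ('b, 'c) rmat \<Rightarrow> ('a, 'c) rmat"
    ("_ \<cdot>\<^bsub>_\<^esub> _" [71, 0, 70] 70) where
  "A \<cdot>\<^bsub>I\<^esub> B = (\<lambda>i k. \<Sum>j\<in>I. A i j * B j k)"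

definition mat_vec :: "('a, 'b) rmat \<Rightarrow> 'b set \<Rightarrow> 'b rvec \<Rightarrow> 'a rvec"
    ("_ \<star>\<^bsub>_\<^esub> _" [71, 0, 70] 70) where
  "A \<star>\<^bsub>I\<^esub> v = (\<lambda>i. \<Sum>j\<in>I. A i j * v j)"

definition dot_on :: "'a set \<Rightarrow> 'a rvec \<Rightarrow> 'a rvec \<Rightarrow> real" where
  "dot_on I u v = (\<Sum>i\<in>I. u i * v i)"

definition scale_vec :: "real \<Rightarrow> 'a rvec \<Rightarrow> 'a rvec" where
  "scale_vec c v = (\<lambda>i. c * v i)"

definition scale_mat :: "real \<Rightarrow> ('a, 'b) rmat \<Rightarrow> ('a, 'b) rmat" where
  "scale_mat c A = (\<lambda>i j. c * A i j)"

definition trp :: "('a, 'b) rmat \<Rightarrow> ('b, 'a) rmat" where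
  "trp A = (\<lambda>i j. A j i)"

definition outer :: "'a rvec \<Rightarrow> 'b rvec \<Rightarrow> ('a, 'b) rmat" where
  "outer u v = (\<lambda>i j. u i * v j)"

definition unit_rvec :: "'a \<Rightarrow> 'a rvec" where
  "unit_rvec k = (\<lambda>i. if i = k then 1 else 0)"

definition diag_mat :: "'a rvec \<Rightarrow> ('a, 'a) rmat" where
  "diag_mat v = (\<lambda>i j. if i = j then v i else 0)"

definition mat_eq :: "'a set \<Rightarrow> ('a, 'a) rmat \<Rightarrow> ('a, 'a) rmat \<Rightarrow> bool" where
  "mat_eq I A B \<longleftrightarrow> (\<forall>i\<in>I. \<forall>j\<in>I. A i j = B i j)"

text \<open>
  The condition outside \<open>I\<close> only makes the representing function unique; the value is
  meaningful when \<open>A\<close> is invertible on \<open>I\<close>.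
\<close>
definition mat_inv :: "'a set \<Rightarrow> ('a, 'a) rmat \<Rightarrow> ('a, 'a) rmat" where
  "mat_inv I A = (THE B. mat_eq I (A \<cdot>\<^bsub>I\<^esub> B) (diag_mat (\<lambda>_. 1)) \<and>
                         mat_eq I (B \<cdot>\<^bsub>I\<^esub> A) (diag_mat (\<lambda>_. 1)) \<and>
                         (\<forall>i j. i \<notin> I \<or> j \<notin> I \<longrightarrow> B i j = 0))"

definition is_diagonal :: "'a set \<Rightarrow> ('a, 'a) rmat \<Rightarrow> bool" where
  "is_diagonal I A \<longleftrightarrow> (\<forall>i\<in>I. \<forall>j\<in>I. i \<noteq> j \<longrightarrow> A i j = 0)"

definition sym_mat :: "'a set \<Rightarrow> ('a, 'a) rmat \<Rightarrow> bool" where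
  "sym_mat I A \<longleftrightarrow> mat_eq I (trp A) A"

definition pos_semidef_mat :: "'a set \<Rightarrow> ('a, 'a) rmat \<Rightarrow> bool" where
  "pos_semidef_mat I A \<longleftrightarrow> (\<forall>v. 0 \<le> dot_on I v (A \<star>\<^bsub>I\<^esub> v))"

definition pos_def_mat :: "'a set \<Rightarrow> ('a, 'a) rmat \<Rightarrow> bool" where
  "pos_def_mat I A \<longleftrightarrow> (\<forall>v. (\<exists>i\<in>I. v i \<noteq> 0) \<longrightarrow> 0 < dot_on I v (A \<star>\<^bsub>I\<^esub> v))"

text \<open>
  The matrices \<open>A\<^sub>1\<^sub>1\<close> and \<open>D\<^sub>1\<^sub>1\<close> take the coefficient grid function
  as argument; \<open>beta\<close> is the constant in \<open>\<zeta> = h beta\<close>.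
\<close>
record sbp_op =
  N :: nat
  Hm :: "(nat, nat) rmat"
  Qm :: "(nat, nat) rmat"
  b0 :: "nat rvec"
  bN :: "nat rvec"
  D11 :: "nat rvec \<Rightarrow> (nat, nat) rmat"
  A11 :: "nat rvec \<Rightarrow> (nat, nat) rmat"
  mb :: nat
  beta :: real

definition pts :: "sbp_op \<Rightarrow> nat set" where
  "pts P = {0..N P}"

definition D1 :: "sbp_op \<Rightarrow> (nat, nat) rmat" where
  "D1 P = mat_inv (pts P) (Hm P) \<cdot>\<^bsub>pts P\<^esub> Qm P"

definition spacing :: "sbp_op \<Rightarrow> real" where
  "spacing P = 1 / real (N P)"

definition zeta :: "sbp_op \<Rightarrow> real" where
  "zeta P = spacing P * beta P"

definition Delta0 :: "sbp_op \<Rightarrow> nat rvec" where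
  "Delta0 P = b0 P - trp (D1 P) \<star>\<^bsub>pts P\<^esub> unit_rvec 0"

definition DeltaN :: "sbp_op \<Rightarrow> nat rvec" where
  "DeltaN P = bN P - trp (D1 P) \<star>\<^bsub>pts P\<^esub> unit_rvec (N P)"

definition Cmin0 :: "sbp_op \<Rightarrow> nat rvec \<Rightarrow> real" where
  "Cmin0 P C = Min (C ` {k \<in> pts P. k < mb P})"

definition CminN :: "sbp_op \<Rightarrow> nat rvec \<Rightarrow> real" where
  "CminN P C = Min (C ` {k \<in> pts P. N P - k < mb P})"

definition is_sbp_op :: "sbp_op \<Rightarrow> bool" where
  "is_sbp_op P \<longleftrightarrow>
     1 \<le> N P \<and>
     is_diagonal (pts P) (Hm P) \<and> pos_def_mat (pts P) (Hm P) \<and>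
     mat_eq (pts P) (Qm P + trp (Qm P))
       (outer (unit_rvec (N P)) (unit_rvec (N P)) - outer (unit_rvec 0) (unit_rvec 0)) \<and>
     1 \<le> mb P \<and> mb P \<le> N P + 1 \<and> 0 < beta P \<and>
     (\<forall>C. (\<forall>k\<in>pts P. 0 < C k) \<longrightarrow>
        sym_mat (pts P) (A11 P C) \<and> pos_semidef_mat (pts P) (A11 P C) \<and>
        mat_eq (pts P) (Hm P \<cdot>\<^bsub>pts P\<^esub> D11 P C)
          (- A11 P C + scale_mat (C (N P)) (outer (unit_rvec (N P)) (bN P))
                     - scale_mat (C 0) (outer (unit_rvec 0) (b0 P))) \<and>
        (\<exists>S. pos_semidef_mat (pts P) S \<and>
          mat_eq (pts P) (A11 P C)
            (trp (D1 P) \<cdot>\<^bsub>pts P\<^esub> diag_mat C \<cdot>\<^bsub>pts P\<^esub> Hm P \<cdot>\<^bsub>pts P\<^esub> D1 P + S +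
             scale_mat (zeta P)
               (scale_mat (Cmin0 P C) (outer (Delta0 P) (Delta0 P)) +
                scale_mat (CminN P C) (outer (DeltaN P) (DeltaN P))))))"

text \<open>
  Directions are \<open>1, \<dots>, d\<close>; \<open>P i\<close> is the one-dimensional operator used along direction \<open>i\<close>.
  Grid points are extensional multi-indices.
\<close>

type_synonym point = "nat \<Rightarrow> nat"

definition grid :: "nat \<Rightarrow> (nat \<Rightarrow> sbp_op) \<Rightarrow> point set" where
  "grid d P = (\<Pi>\<^sub>E i\<in>{1..d}. pts (P i))"

definition tensor :: "nat set \<Rightarrow> (nat \<Rightarrow> (nat, nat) rmat) \<Rightarrow> (point, point) rmat" where
  "tensor J M = (\<lambda>x y. \<Prod>j\<in>J. M j (x j) (y j))"

text \<open>The tensor product of \<open>M\<close> in direction \<open>i\<close> with identities in all other directions.\<close>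
definition along :: "nat \<Rightarrow> (nat, nat) rmat \<Rightarrow> (point, point) rmat" where
  "along i M = (\<lambda>x y. if \<forall>j. j \<noteq> i \<longrightarrow> x j = y j then M (x i) (y i) else 0)"

definition Ht :: "nat \<Rightarrow> (nat \<Rightarrow> sbp_op) \<Rightarrow> (point, point) rmat" where
  "Ht d P = tensor {1..d} (\<lambda>i. Hm (P i))"

definition Dt :: "(nat \<Rightarrow> sbp_op) \<Rightarrow> nat \<Rightarrow> (point, point) rmat" where
  "Dt P i = along i (D1 (P i))"

text \<open>
  A grid line in direction \<open>i\<close> is given by its indices \<open>l\<close> in the other directions; its points are
  \<open>l(i := k)\<close>.
\<close>
definition lines :: "nat \<Rightarrow> (nat \<Rightarrow> sbp_op) \<Rightarrow> nat \<Rightarrow> point set" where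
  "lines d P i = (\<Pi>\<^sub>E j\<in>{1..d} - {i}. pts (P j))"

definition on_line :: "nat \<Rightarrow> point \<Rightarrow> (nat, nat) rmat \<Rightarrow> (point, point) rmat" where
  "on_line i l M = (\<lambda>x y. if x = l(i := x i) \<and> y = l(i := y i) then M (x i) (y i) else 0)"

definition At :: "nat \<Rightarrow> (nat \<Rightarrow> sbp_op) \<Rightarrow> nat \<Rightarrow> nat \<Rightarrow> point rvec \<Rightarrow> (point, point) rmat" where
  "At d P i j C =
     (if i = j
      then \<Sum>l\<in>lines d P i. scale_mat (\<Prod>k\<in>{1..d} - {i}. Hm (P k) (l k) (l k))
             (on_line i l (A11 (P i) (\<lambda>k. C (l(i := k)))))
      else trp (Dt P i) \<cdot>\<^bsub>grid d P\<^esub> diag_mat C \<cdot>\<^bsub>grid d P\<^esub> Ht d P \<cdot>\<^bsub>grid d P\<^esub> Dt P j)"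

text \<open>
  Points of a face are identified with the points of the full grid lying on that face, so the
  values of a coefficient on the face are read off directly from the coefficient.
\<close>

definition face_dir :: "nat \<Rightarrow> nat" where
  "face_dir f = nat \<lceil>real f / 2\<rceil>"

definition face :: "nat \<Rightarrow> (nat \<Rightarrow> sbp_op) \<Rightarrow> nat \<Rightarrow> point set" where
  "face d P f =
     {x \<in> grid d P. x (face_dir f) = (if odd f then 0 else N (P (face_dir f)))}"

definition normal :: "nat \<Rightarrow> nat \<Rightarrow> real" where
  "normal f i = (if i = face_dir f then (-1) ^ f else 0)"

text \<open>The rows of the next two matrices are indexed by the face, the columns by the grid.\<close>

definition Lf :: "(point, point) rmat" where
  "Lf = (\<lambda>x y. if x = y then 1 else 0)"

definition Bf :: "nat \<Rightarrow> (nat \<Rightarrow> sbp_op) \<Rightarrow> nat \<Rightarrow> nat \<Rightarrow> (point, point) rmat" where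
  "Bf d P f j =
     (if j = face_dir f
      then along j (\<lambda>_. if odd f then b0 (P j) else bN (P j))
      else Lf \<cdot>\<^bsub>grid d P\<^esub> Dt P j)"

definition Hf :: "nat \<Rightarrow> (nat \<Rightarrow> sbp_op) \<Rightarrow> nat \<Rightarrow> (point, point) rmat" where
  "Hf d P f = tensor ({1..d} - {face_dir f}) (\<lambda>i. Hm (P i))"

text \<open>
  \<open>C i j\<close> are the coefficient grid functions, and \<open>\<gamma> f\<close> is the diagonal of the penalty
  matrix of face \<open>f\<close>.
\<close>

definition Tf :: "nat \<Rightarrow> (nat \<Rightarrow> sbp_op) \<Rightarrow> (nat \<Rightarrow> nat \<Rightarrow> point rvec) \<Rightarrow> point rvec \<Rightarrow>
    nat \<Rightarrow> point rvec" where
  "Tf d P C u f =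
     (\<Sum>i\<in>{1..d}. \<Sum>j\<in>{1..d}.
        scale_vec (normal f i) (diag_mat (C i j) \<star>\<^bsub>face d P f\<^esub> Bf d P f j \<star>\<^bsub>grid d P\<^esub> u))"

definition Xf :: "nat \<Rightarrow> (nat \<Rightarrow> sbp_op) \<Rightarrow> (nat \<Rightarrow> nat \<Rightarrow> point rvec) \<Rightarrow>
    (nat \<Rightarrow> point rvec) \<Rightarrow> nat \<Rightarrow> (point, point) rmat" where
  "Xf d P C \<gamma> f =
     (\<Sum>i\<in>{1..d}. \<Sum>j\<in>{1..d}.
        scale_mat (normal f i * normal f j) (diag_mat (C i j) \<cdot>\<^bsub>face d P f\<^esub> diag_mat (\<gamma> f)))"

definition tauf :: "nat \<Rightarrow> (nat \<Rightarrow> sbp_op) \<Rightarrow> (nat \<Rightarrow> nat \<Rightarrow> point rvec) \<Rightarrow>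
    (nat \<Rightarrow> point rvec) \<Rightarrow> point rvec \<Rightarrow> (nat \<Rightarrow> point rvec) \<Rightarrow> nat \<Rightarrow> point rvec" where
  "tauf d P C \<gamma> u us f =
     Tf d P C u f + Xf d P C \<gamma> f \<star>\<^bsub>face d P f\<^esub> (us f - Lf \<star>\<^bsub>grid d P\<^esub> u)"

definition block_energy :: "nat \<Rightarrow> (nat \<Rightarrow> sbp_op) \<Rightarrow> (nat \<Rightarrow> nat \<Rightarrow> point rvec) \<Rightarrow>
    point rvec \<Rightarrow> (nat \<Rightarrow> point rvec) \<Rightarrow> point rvec \<Rightarrow> point rvec \<Rightarrow> (nat \<Rightarrow> point rvec) \<Rightarrow> real" where
  "block_energy d P C \<rho> \<gamma> u v us =
     1/2 * dot_on (grid d P) v (Ht d P \<star>\<^bsub>grid d P\<^esub> diag_mat \<rho> \<star>\<^bsub>grid d P\<^esub> v) +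
     1/2 * (\<Sum>i\<in>{1..d}. \<Sum>j\<in>{1..d}.
              dot_on (grid d P) u (At d P i j (C i j) \<star>\<^bsub>grid d P\<^esub> u)) +
     1/2 * (\<Sum>f\<in>{1..2 * d}.
              dot_on (face d P f) (tauf d P C \<gamma> u us f)
                (mat_inv (face d P f) (Xf d P C \<gamma> f) \<star>\<^bsub>face d P f\<^esub>
                   Hf d P f \<star>\<^bsub>face d P f\<^esub> tauf d P C \<gamma> u us f) -
              dot_on (face d P f) (Tf d P C u f)
                (mat_inv (face d P f) (Xf d P C \<gamma> f) \<star>\<^bsub>face d P f\<^esub>
                   Hf d P f \<star>\<^bsub>face d P f\<^esub> Tf d P C u f))"

end

theory Submission
  imports Defs
begin

text \<open>
  The only part of the block energy that can be negative is the sum of the traction terms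
  \<open>- T\<^sup>T X\<^sup>-\<^sup>1 H T\<close>.  These carry the factor \<open>1/\<gamma>\<close>, and everything in them is
  controlled by the elastic energy, so a large penalty makes them harmless.

  On a face with normal direction \<open>i\<close> the traction is, up to sign,
  \<open>T = s + C\<^sub>i\<^sub>i \<delta>\<close> with \<open>s = \<Sum>\<^sub>j C\<^sub>i\<^sub>j D\<^sub>j u\<close>.  Here \<open>\<delta>\<close> is the mismatch
  between the boundary derivative vector and the boundary row of \<open>D\<^sub>1\<close>, because only the
  normal derivative in the traction is taken with the boundary derivative vector
  (\<open>Tf_apply\<close>).  The two parts are paid for differently.

  The part \<open>s\<close> is a row of the coefficient matrix applied to the discrete gradient, so
  Cauchy-Schwarz for the form of \<open>C\<close> gives \<open>s\<^sup>2 \<le> C\<^sub>i\<^sub>i q\<close>, where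
  \<open>q = \<Sum>\<^sub>i\<^sub>j C\<^sub>i\<^sub>j D\<^sub>i u D\<^sub>j u\<close> (\<open>row_cauchy_schwarz\<close>).  A point of a face
  is also a grid point, whose volume weight is the face weight times one diagonal entry of the
  one-dimensional \<open>H\<close>; so the pointwise strain energy \<open>q\<close> of the grid is available there,
  and each of the \<open>2 d\<close> faces may spend the fraction \<open>1/(2 d)\<close> of it.

  The part \<open>C\<^sub>i\<^sub>i \<delta>\<close> is not seen by \<open>q\<close> at all.  It is absorbed by the borrowing
  terms \<open>\<zeta> C\<^sup>m\<^sup>i\<^sup>n \<delta>\<^sup>2\<close> of the one-dimensional matrices \<open>A\<^sub>1\<^sub>1\<close>, which, summed over
  the grid lines meeting a face, have exactly the weights of that face
  (\<open>elastic_energy_lower_bound\<close>).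

  Both absorptions hold pointwise as soon as \<open>\<gamma>\<close> exceeds an explicit number depending on the
  face point (\<open>traction_pointwise_bound\<close>), and a finite grid has a common upper bound for
  these numbers.
\<close>

section \<open>Diagonal matrices and quadratic forms on finite index sets\<close>

lemma sum_matrix_apply: "(\<Sum>i\<in>A. M i) x y = (\<Sum>i\<in>A. M i x y :: real)"
  by (induction A rule: infinite_finite_induct) auto

lemma sum_vector_apply: "(\<Sum>i\<in>A. v i) x = (\<Sum>i\<in>A. v i x :: real)"
  by (induction A rule: infinite_finite_induct) auto

lemma sum_only_one:
  assumes "finite I" "i \<in> I" "\<And>j. j \<in> I \<Longrightarrow> j \<noteq> i \<Longrightarrow> g j = (0::real)"
  shows "(\<Sum>j\<in>I. g j) = g i"
proof -
  have "(\<Sum>j\<in>I. g j) = (\<Sum>j\<in>{i}. g j)"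
    using assms by (intro sum.mono_neutral_right) auto
  then show ?thesis by simp
qed

lemma mat_vec_diagonal:
  assumes "finite I" "is_diagonal I A" "i \<in> I"
  shows "(A \<star>\<^bsub>I\<^esub> v) i = A i i * v i"
  unfolding mat_vec_def using assms
  by (intro sum_only_one) (auto simp: is_diagonal_def)

lemma mat_mul_diagonal:
  assumes "finite I" "is_diagonal I A" "i \<in> I"
  shows "(A \<cdot>\<^bsub>I\<^esub> B) i k = A i i * B i k"
  unfolding mat_mul_def using assms
  by (subst sum_only_one[of I i]) (auto simp: is_diagonal_def)

lemma is_diagonal_diag_mat: "is_diagonal I (diag_mat v)"
  by (simp add: is_diagonal_def diag_mat_def)

text \<open>
  The inverse is characterised by a unique description, so the entrywise reciprocal has to be
  shown to be the only candidate; the zero entries off \<open>I\<close> belong to that description.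
\<close>
lemma mat_inv_diagonal:
  assumes "finite I" "is_diagonal I A" "\<And>i. i \<in> I \<Longrightarrow> A i i \<noteq> 0"
  shows "mat_inv I A = (\<lambda>i j. if i = j \<and> i \<in> I then 1 / A i i else 0)"
  unfolding mat_inv_def
proof (rule the_equality, intro conjI)
  let ?B = "\<lambda>i j. if i = j \<and> i \<in> I then 1 / A i i else 0"
  have B: "is_diagonal I ?B" by (simp add: is_diagonal_def)
  show "mat_eq I (A \<cdot>\<^bsub>I\<^esub> ?B) (diag_mat (\<lambda>_. 1))"
    using assms by (auto simp: mat_eq_def mat_mul_diagonal diag_mat_def)
  show "mat_eq I (?B \<cdot>\<^bsub>I\<^esub> A) (diag_mat (\<lambda>_. 1))"
    using assms(2,3) unfolding mat_eq_def
    by (auto simp only: mat_mul_diagonal[OF assms(1) B]) (auto simp: diag_mat_def is_diagonal_def)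
  show "\<forall>i j. i \<notin> I \<or> j \<notin> I \<longrightarrow> ?B i j = 0" by auto
next
  fix B
  assume B: "mat_eq I (A \<cdot>\<^bsub>I\<^esub> B) (diag_mat (\<lambda>_. 1)) \<and>
    mat_eq I (B \<cdot>\<^bsub>I\<^esub> A) (diag_mat (\<lambda>_. 1)) \<and> (\<forall>i j. i \<notin> I \<or> j \<notin> I \<longrightarrow> B i j = 0)"
  show "B = (\<lambda>i j. if i = j \<and> i \<in> I then 1 / A i i else 0)"
  proof (intro ext)
    fix i j
    show "B i j = (if i = j \<and> i \<in> I then 1 / A i i else 0)"
    proof (cases "i \<in> I \<and> j \<in> I")
      case True
      then have "A i i * B i j = (if i = j then 1 else 0)"
        using B assms mat_mul_diagonal[OF assms(1,2), of i B j]
        by (auto simp: mat_eq_def diag_mat_def)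
      then show ?thesis using True assms(3)[of i] by (auto simp: field_simps split: if_splits)
    next
      case False
      then show ?thesis using B by auto
    qed
  qed
qed

lemma dot_mat_inv_diagonal:
  assumes "finite I" "is_diagonal I X" "is_diagonal I H" "\<And>i. i \<in> I \<Longrightarrow> X i i \<noteq> 0"
  shows "dot_on I t (mat_inv I X \<star>\<^bsub>I\<^esub> H \<star>\<^bsub>I\<^esub> t) = (\<Sum>i\<in>I. H i i * (t i)\<^sup>2 / X i i)"
proof -
  have inv: "mat_inv I X = (\<lambda>i j. if i = j \<and> i \<in> I then 1 / X i i else 0)"
    by (rule mat_inv_diagonal) (use assms in auto)
  have dg: "is_diagonal I (mat_inv I X)" by (simp add: inv is_diagonal_def)
  show ?thesis
    unfolding dot_on_def
  proof (rule sum.cong)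
    fix i assume i: "i \<in> I"
    have "(mat_inv I X \<star>\<^bsub>I\<^esub> H \<star>\<^bsub>I\<^esub> t) i = mat_inv I X i i * (H i i * t i)"
      using i assms by (simp only: mat_vec_diagonal[OF _ dg] mat_vec_diagonal)
    then show "t i * (mat_inv I X \<star>\<^bsub>I\<^esub> H \<star>\<^bsub>I\<^esub> t) i = H i i * (t i)\<^sup>2 / X i i"
      using i by (simp add: inv power2_eq_square)
  qed simp
qed

text \<open>
  With diagonal weights the product \<open>A\<^sup>T c H B\<close> is a weighted pairing of \<open>A u\<close> with
  \<open>B v\<close>.  This is the form of the volume part of the energy both in one dimension and for the
  mixed derivatives on the grid.
\<close>
lemma dot_congruence_diagonal:
  assumes "finite I" "is_diagonal I H"
  shows "dot_on I u ((trp A \<cdot>\<^bsub>I\<^esub> diag_mat c \<cdot>\<^bsub>I\<^esub> H \<cdot>\<^bsub>I\<^esub> B) \<star>\<^bsub>I\<^esub> v) =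
    (\<Sum>x\<in>I. c x * H x x * (A \<star>\<^bsub>I\<^esub> u) x * (B \<star>\<^bsub>I\<^esub> v) x)"
proof -
  have mid: "(diag_mat c \<cdot>\<^bsub>I\<^esub> H \<cdot>\<^bsub>I\<^esub> B) x j = c x * H x x * B x j" if "x \<in> I" for x j
    using that assms
    by (simp add: mat_mul_diagonal[OF assms(1) is_diagonal_diag_mat] mat_mul_diagonal)
      (simp add: diag_mat_def)
  have "dot_on I u ((trp A \<cdot>\<^bsub>I\<^esub> diag_mat c \<cdot>\<^bsub>I\<^esub> H \<cdot>\<^bsub>I\<^esub> B) \<star>\<^bsub>I\<^esub> v) =
      (\<Sum>i\<in>I. \<Sum>j\<in>I. \<Sum>x\<in>I. u i * (A x i * (c x * H x x * B x j) * v j))"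
    unfolding dot_on_def mat_vec_def
    by (subst mat_mul_def) (simp add: mid trp_def sum_distrib_left sum_distrib_right)
  also have "\<dots> = (\<Sum>i\<in>I. \<Sum>x\<in>I. \<Sum>j\<in>I. u i * (A x i * (c x * H x x * B x j) * v j))"
    by (intro sum.cong refl sum.swap)
  also have "\<dots> = (\<Sum>x\<in>I. \<Sum>i\<in>I. \<Sum>j\<in>I. u i * (A x i * (c x * H x x * B x j) * v j))"
    by (rule sum.swap)
  also have "\<dots> = (\<Sum>x\<in>I. c x * H x x * (A \<star>\<^bsub>I\<^esub> u) x * (B \<star>\<^bsub>I\<^esub> v) x)"
    unfolding mat_vec_def
    by (intro sum.cong refl)
      (simp add: sum_product sum_distrib_left algebra_simps)
  finally show ?thesis .
qed

lemma dot_mat_vec_cong: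
  "mat_eq I A B \<Longrightarrow> dot_on I u (A \<star>\<^bsub>I\<^esub> v) = dot_on I u (B \<star>\<^bsub>I\<^esub> v)"
  by (auto simp: dot_on_def mat_vec_def mat_eq_def intro!: sum.cong)

lemma mat_vec_add_mat: "(A + B) \<star>\<^bsub>I\<^esub> v = A \<star>\<^bsub>I\<^esub> v + B \<star>\<^bsub>I\<^esub> v"
  by (simp add: fun_eq_iff mat_vec_def sum.distrib algebra_simps)

lemma mat_vec_scale_mat: "scale_mat c A \<star>\<^bsub>I\<^esub> v = scale_vec c (A \<star>\<^bsub>I\<^esub> v)"
  by (simp add: fun_eq_iff mat_vec_def scale_mat_def scale_vec_def sum_distrib_left algebra_simps)

lemma mat_vec_outer: "outer a b \<star>\<^bsub>I\<^esub> v = scale_vec (dot_on I b v) a"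
  by (simp add: fun_eq_iff mat_vec_def outer_def scale_vec_def dot_on_def sum_distrib_right
      sum_distrib_left algebra_simps)

lemma dot_on_add: "dot_on I u (v + w) = dot_on I u v + dot_on I u w"
  by (simp add: dot_on_def sum.distrib algebra_simps)

lemma dot_on_scale: "dot_on I u (scale_vec c v) = c * dot_on I u v"
  by (simp add: dot_on_def scale_vec_def sum_distrib_left algebra_simps)

lemma dot_mat_vec_sum:
  assumes "finite L"
  shows "dot_on I u ((\<Sum>l\<in>L. M l) \<star>\<^bsub>I\<^esub> v) = (\<Sum>l\<in>L. dot_on I u (M l \<star>\<^bsub>I\<^esub> v))"
  using assms
proof (induction L rule: finite_induct)
  case empty
  then show ?case by (simp add: dot_on_def mat_vec_def)
next
  case (insert l L)
  show ?case
    unfolding sum.insert[OF insert.hyps] mat_vec_add_mat dot_on_add insert.IH ..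
qed

lemma dot_on_commute: "dot_on I u v = dot_on I v u"
  by (simp add: dot_on_def mult.commute)

lemma pos_def_diagonal_entry:
  assumes "finite I" "pos_def_mat I A" "i \<in> I"
  shows "0 < A i i"
proof -
  have "0 < dot_on I (unit_rvec i) (A \<star>\<^bsub>I\<^esub> unit_rvec i)"
    using assms(2,3) by (auto simp: pos_def_mat_def unit_rvec_def)
  also have "\<dots> = A i i"
    unfolding dot_on_def mat_vec_def
    by (subst sum_only_one[of I i], (use assms in \<open>auto simp: unit_rvec_def\<close>)[3],
        subst sum_only_one[of I i]) (use assms in \<open>auto simp: unit_rvec_def\<close>)
  finally show ?thesis .
qed

lemma pos_def_form_nonneg:
  assumes "pos_def_mat I A"
  shows "0 \<le> dot_on I v (A \<star>\<^bsub>I\<^esub> v)"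
proof (cases "\<exists>i\<in>I. v i \<noteq> 0")
  case True
  then show ?thesis using assms by (auto simp: pos_def_mat_def less_imp_le)
next
  case False
  then show ?thesis by (simp add: dot_on_def)
qed

text \<open>
  This is the Cauchy-Schwarz inequality in the inner product of \<open>A\<close> for \<open>g\<close> and the
  \<open>i\<close>-th unit vector: \<open>(A g)\<^sub>i\<close> is their product and \<open>A\<^sub>i\<^sub>i\<close> is the squared norm of
  the unit vector.
\<close>
lemma row_cauchy_schwarz:
  assumes fin: "finite I" and sym: "sym_mat I A" and pd: "pos_def_mat I A" and i: "i \<in> I"
  shows "((A \<star>\<^bsub>I\<^esub> g) i)\<^sup>2 \<le> A i i * dot_on I g (A \<star>\<^bsub>I\<^esub> g)"
proof -
  let ?r = "(A \<star>\<^bsub>I\<^esub> g) i" and ?q = "dot_on I g (A \<star>\<^bsub>I\<^esub> g)"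
  let ?e = "unit_rvec i"
  \<comment> \<open>The minimiser of the quadratic form along the line \<open>g + t e\<^sub>i\<close>.\<close>
  define t where "t = - ?r / A i i"
  have Aii: "0 < A i i" by (rule pos_def_diagonal_entry[OF fin pd i])
  have Ae: "(A \<star>\<^bsub>I\<^esub> ?e) k = A k i" for k
    unfolding mat_vec_def
    by (subst sum_only_one[of I i]) (use fin i in \<open>auto simp: unit_rvec_def\<close>)
  have dot_e: "dot_on I ?e w = w i" for w
    unfolding dot_on_def
    by (subst sum_only_one[of I i]) (use fin i in \<open>auto simp: unit_rvec_def\<close>)
  have gAe: "dot_on I g (A \<star>\<^bsub>I\<^esub> ?e) = ?r"
  proof -
    have "dot_on I g (A \<star>\<^bsub>I\<^esub> ?e) = (\<Sum>k\<in>I. A k i * g k)"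
      by (simp add: dot_on_def Ae mult.commute)
    also have "\<dots> = (\<Sum>k\<in>I. A i k * g k)"
      using sym i by (intro sum.cong) (auto simp: sym_mat_def mat_eq_def trp_def)
    finally show ?thesis by (simp add: mat_vec_def)
  qed
  have lin: "A \<star>\<^bsub>I\<^esub> (g + scale_vec t ?e) = A \<star>\<^bsub>I\<^esub> g + scale_vec t (A \<star>\<^bsub>I\<^esub> ?e)"
    by (simp add: fun_eq_iff mat_vec_def scale_vec_def sum.distrib sum_distrib_left algebra_simps)
  have "0 \<le> dot_on I (g + scale_vec t ?e) (A \<star>\<^bsub>I\<^esub> (g + scale_vec t ?e))"
    by (rule pos_def_form_nonneg[OF pd])
  also have "\<dots> = ?q + 2 * t * ?r + t\<^sup>2 * A i i"
    unfolding lin dot_on_add dot_on_scale gAe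
      dot_on_commute[of I "g + scale_vec t ?e"]
    by (simp add: dot_on_add dot_on_scale dot_on_commute[of I _ ?e] dot_e Ae
        dot_on_commute[of I _ g] gAe power2_eq_square algebra_simps)
  also have "\<dots> = ?q - ?r\<^sup>2 / A i i"
    using Aii by (simp add: t_def power2_eq_square field_simps)
  finally show ?thesis
    using Aii by (simp add: field_simps)
qed

section \<open>The one-dimensional energy\<close>

text \<open>
  Odd face numbers belong to the left endpoint and even ones to the right endpoint, so the
  one-dimensional boundary data can be selected by the parity of the face number.
\<close>
definition boundary_index :: "sbp_op \<Rightarrow> nat \<Rightarrow> nat" where
  "boundary_index P f = (if odd f then 0 else N P)"

definition boundary_derivative :: "sbp_op \<Rightarrow> nat \<Rightarrow> nat rvec" where
  "boundary_derivative P f = (if odd f then b0 P else bN P)"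

text \<open>
  The quantity \<open>C\<^sub>k\<^sup>m\<^sup>i\<^sup>n\<close> of the borrowing property.
\<close>
definition near_boundary_min :: "sbp_op \<Rightarrow> nat \<Rightarrow> nat rvec \<Rightarrow> real" where
  "near_boundary_min P f C = (if odd f then Cmin0 P C else CminN P C)"

text \<open>
  This is \<open>\<Delta>\<^sub>k\<^sup>T v\<close>, in the form in which it arises when the traction is split.
\<close>
definition derivative_mismatch :: "sbp_op \<Rightarrow> nat \<Rightarrow> nat rvec \<Rightarrow> real" where
  "derivative_mismatch P f v =
     dot_on (pts P) (boundary_derivative P f) v - (D1 P \<star>\<^bsub>pts P\<^esub> v) (boundary_index P f)"

lemma finite_pts [simp]: "finite (pts P)"
  by (simp add: pts_def)

lemma boundary_index_in_pts: "boundary_index P f \<in> pts P"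
  by (simp add: boundary_index_def pts_def)

lemma sbp_Hm_diagonal: "is_sbp_op P \<Longrightarrow> is_diagonal (pts P) (Hm P)"
  by (simp add: is_sbp_op_def)

lemma sbp_Hm_pos:
  assumes "is_sbp_op P" "k \<in> pts P"
  shows "0 < Hm P k k"
  using assms by (intro pos_def_diagonal_entry[of "pts P"]) (auto simp: is_sbp_op_def)

lemma near_boundary_min_pos:
  assumes "is_sbp_op P" "\<And>k. k \<in> pts P \<Longrightarrow> 0 < C k"
  shows "0 < near_boundary_min P f C"
proof -
  have "0 \<in> {k \<in> pts P. k < mb P}" "N P \<in> {k \<in> pts P. N P - k < mb P}"
    using assms(1) by (auto simp: is_sbp_op_def pts_def)
  then have "C ` {k \<in> pts P. k < mb P} \<noteq> {}" "C ` {k \<in> pts P. N P - k < mb P} \<noteq> {}"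
    by blast+
  then show ?thesis
    using assms(2) by (auto simp: near_boundary_min_def Cmin0_def CminN_def)
qed

lemma zeta_pos: "is_sbp_op P \<Longrightarrow> 0 < zeta P"
  by (auto simp: is_sbp_op_def zeta_def spacing_def)

lemma dot_boundary_gap:
  assumes "k \<in> pts P"
  shows "dot_on (pts P) (b - trp (D1 P) \<star>\<^bsub>pts P\<^esub> unit_rvec k) v =
    dot_on (pts P) b v - (D1 P \<star>\<^bsub>pts P\<^esub> v) k"
proof -
  have "(trp (D1 P) \<star>\<^bsub>pts P\<^esub> unit_rvec k) j = D1 P k j" for j
    unfolding mat_vec_def
    by (subst sum_only_one[of _ k]) (use assms in \<open>auto simp: unit_rvec_def trp_def\<close>)
  then show ?thesis
    by (simp add: dot_on_def mat_vec_def sum_subtractf algebra_simps)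
qed

text \<open>
  The borrowing decomposition of \<open>A\<^sub>1\<^sub>1\<close> without its semidefinite remainder.  The faces
  \<open>1\<close> and \<open>2\<close> stand for the two endpoints.
\<close>
lemma sbp_energy_lower_bound:
  assumes "is_sbp_op P" and C: "\<And>k. k \<in> pts P \<Longrightarrow> 0 < C k"
  shows "(\<Sum>k\<in>pts P. C k * Hm P k k * ((D1 P \<star>\<^bsub>pts P\<^esub> v) k)\<^sup>2) +
      zeta P * (near_boundary_min P 1 C * (derivative_mismatch P 1 v)\<^sup>2 +
                near_boundary_min P 2 C * (derivative_mismatch P 2 v)\<^sup>2)
    \<le> dot_on (pts P) v (A11 P C \<star>\<^bsub>pts P\<^esub> v)"
proof -
  have dg: "is_diagonal (pts P) (Hm P)" by (rule sbp_Hm_diagonal[OF assms(1)])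
  obtain S where S: "pos_semidef_mat (pts P) S" and
    A: "mat_eq (pts P) (A11 P C)
            (trp (D1 P) \<cdot>\<^bsub>pts P\<^esub> diag_mat C \<cdot>\<^bsub>pts P\<^esub> Hm P \<cdot>\<^bsub>pts P\<^esub> D1 P + S +
             scale_mat (zeta P)
               (scale_mat (Cmin0 P C) (outer (Delta0 P) (Delta0 P)) +
                scale_mat (CminN P C) (outer (DeltaN P) (DeltaN P))))"
    using assms unfolding is_sbp_op_def by blast
  have "0 \<in> pts P" "N P \<in> pts P" by (simp_all add: pts_def)
  then have gap: "dot_on (pts P) (Delta0 P) v = derivative_mismatch P 1 v"
      "dot_on (pts P) (DeltaN P) v = derivative_mismatch P 2 v"
    unfolding Delta0_def DeltaN_def derivative_mismatch_def
    by (simp_all only: dot_boundary_gap) (simp_all add: boundary_index_def boundary_derivative_def)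
  have "dot_on (pts P) v (A11 P C \<star>\<^bsub>pts P\<^esub> v) =
      (\<Sum>k\<in>pts P. C k * Hm P k k * ((D1 P \<star>\<^bsub>pts P\<^esub> v) k)\<^sup>2) + dot_on (pts P) v (S \<star>\<^bsub>pts P\<^esub> v) +
      zeta P * (near_boundary_min P 1 C * (derivative_mismatch P 1 v)\<^sup>2 +
                near_boundary_min P 2 C * (derivative_mismatch P 2 v)\<^sup>2)"
    unfolding dot_mat_vec_cong[OF A] mat_vec_add_mat mat_vec_scale_mat mat_vec_outer
      dot_on_add dot_on_scale dot_congruence_diagonal[OF finite_pts dg]
    by (simp add: dot_on_commute[of _ v] gap near_boundary_min_def power2_eq_square mult.assoc)
  moreover have "0 \<le> dot_on (pts P) v (S \<star>\<^bsub>pts P\<^esub> v)"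
    using S by (simp add: pos_semidef_mat_def)
  ultimately show ?thesis by simp
qed

section \<open>Grid lines and faces\<close>

lemma finite_grid [simp]: "finite (grid d P)"
  by (simp add: grid_def finite_PiE)

lemma finite_lines [simp]: "finite (lines d P i)"
  by (simp add: lines_def finite_PiE)

lemma finite_face [simp]: "finite (face d P f)"
  by (simp add: face_def)

lemma face_subset_grid: "face d P f \<subseteq> grid d P"
  by (auto simp: face_def)

lemma grid_coord: "x \<in> grid d P \<Longrightarrow> i \<in> {1..d} \<Longrightarrow> x i \<in> pts (P i)"
  by (auto simp: grid_def PiE_iff)

lemma grid_upd: "x \<in> grid d P \<Longrightarrow> i \<in> {1..d} \<Longrightarrow> k \<in> pts (P i) \<Longrightarrow> x(i := k) \<in> grid d P"
  by (auto simp: grid_def PiE_iff extensional_def)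

lemma line_upd: "l \<in> lines d P i \<Longrightarrow> i \<in> {1..d} \<Longrightarrow> k \<in> pts (P i) \<Longrightarrow> l(i := k) \<in> grid d P"
  by (auto simp: grid_def lines_def PiE_iff extensional_def)

text \<open>
  A multi-index of a line is extensional, so dropping coordinate \<open>i\<close> means resetting it to
  the default value.
\<close>
lemma line_of_point: "x \<in> grid d P \<Longrightarrow> i \<in> {1..d} \<Longrightarrow> x(i := undefined) \<in> lines d P i"
  by (auto simp: grid_def lines_def PiE_iff extensional_def)

lemma line_undefined: "l \<in> lines d P i \<Longrightarrow> l(i := undefined) = l"
  by (auto simp: lines_def PiE_iff extensional_def fun_eq_iff)

lemma sum_grid_by_lines:
  assumes i: "i \<in> {1..d}"
  shows "(\<Sum>x\<in>grid d P. g x :: real) = (\<Sum>l\<in>lines d P i. \<Sum>k\<in>pts (P i). g (l(i := k)))"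
proof -
  have "(\<Sum>x\<in>grid d P. g x) = (\<Sum>(l, k)\<in>lines d P i \<times> pts (P i). g (l(i := k)))"
    by (rule sum.reindex_bij_witness[where i = "\<lambda>(l, k). l(i := k)"
          and j = "\<lambda>x. (x(i := undefined), x i)"])
      (use i in \<open>auto simp: line_upd line_undefined intro: line_of_point grid_coord\<close>)
  then show ?thesis by (simp add: sum.cartesian_product)
qed

lemma face_iff:
  "x \<in> face d P f \<longleftrightarrow>
     x \<in> grid d P \<and> x (face_dir f) = boundary_index (P (face_dir f)) f"
  by (simp add: face_def boundary_index_def)

lemma sum_face_by_lines:
  assumes i: "face_dir f = i" "i \<in> {1..d}"
  shows "(\<Sum>x\<in>face d P f. g x :: real) =
    (\<Sum>l\<in>lines d P i. g (l(i := boundary_index (P i) f)))"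
proof (rule sum.reindex_bij_witness[where i = "\<lambda>l. l(i := boundary_index (P i) f)"
      and j = "\<lambda>x. x(i := undefined)"])
  fix x assume x: "x \<in> face d P f"
  then have eq: "(x(i := undefined))(i := boundary_index (P i) f) = x"
    using i(1) unfolding face_iff by (metis fun_upd_triv fun_upd_upd)
  show "(x(i := undefined))(i := boundary_index (P i) f) = x" by (rule eq)
  show "x(i := undefined) \<in> lines d P i"
    using x i(2) unfolding face_iff by (blast intro: line_of_point)
  show "g ((x(i := undefined))(i := boundary_index (P i) f)) = g x" by (simp only: eq)
next
  fix l assume l: "l \<in> lines d P i"
  show "(l(i := boundary_index (P i) f))(i := undefined) = l"
    using line_undefined[OF l] by simp
  show "l(i := boundary_index (P i) f) \<in> face d P f"
    using line_upd[OF l i(2) boundary_index_in_pts] i(1) by (simp add: face_iff)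
qed

text \<open>
  Here \<open>l\<close> may be a line as well as a grid point on it, which serves both the grid lines
  inside \<open>At\<close> and the operators acting along a direction.
\<close>
lemma sum_grid_on_line:
  assumes "\<And>k. k \<in> pts (P i) \<Longrightarrow> l(i := k) \<in> grid d P" "i \<in> {1..d}"
  shows "(\<Sum>y\<in>grid d P. if y = l(i := y i) then g y else (0::real)) =
    (\<Sum>k\<in>pts (P i). g (l(i := k)))"
proof -
  have "(\<Sum>y\<in>grid d P. if y = l(i := y i) then g y else 0) =
      (\<Sum>y\<in>{y \<in> grid d P. y = l(i := y i)}. g y)"
    by (simp add: sum.If_cases Int_def)
  also have "\<dots> = (\<Sum>k\<in>pts (P i). g (l(i := k)))"
    by (rule sum.reindex_bij_witness[where i = "\<lambda>k. l(i := k)" and j = "\<lambda>y. y i"])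
      (use assms grid_coord[of _ d P i] in auto)
  finally show ?thesis .
qed

lemma mult_if_zero: "(if b then a else 0) * c = (if b then a * c else (0::real))"
  by simp

lemma along_apply:
  assumes "x \<in> grid d P" "i \<in> {1..d}"
  shows "(along i M \<star>\<^bsub>grid d P\<^esub> u) x = (M \<star>\<^bsub>pts (P i)\<^esub> (\<lambda>k. u (x(i := k)))) (x i)"
proof -
  have on: "(\<forall>j. j \<noteq> i \<longrightarrow> x j = y j) \<longleftrightarrow> y = x(i := y i)" for y
  proof
    assume "\<forall>j. j \<noteq> i \<longrightarrow> x j = y j"
    then show "y = x(i := y i)" by (intro ext) simp
  next
    assume "y = x(i := y i)"
    then show "\<forall>j. j \<noteq> i \<longrightarrow> x j = y j" by (metis fun_upd_other)
  qed
  have "(along i M \<star>\<^bsub>grid d P\<^esub> u) x =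
      (\<Sum>y\<in>grid d P. if y = x(i := y i) then M (x i) (y i) * u y else 0)"
    unfolding mat_vec_def along_def on
    by (rule sum.cong[OF refl]) (rule mult_if_zero)
  also have "\<dots> = (M \<star>\<^bsub>pts (P i)\<^esub> (\<lambda>k. u (x(i := k)))) (x i)"
    by (subst sum_grid_on_line) (use assms in \<open>auto simp: grid_upd mat_vec_def\<close>)
  finally show ?thesis .
qed

lemma dot_on_line:
  assumes l: "l \<in> lines d P i" and i: "i \<in> {1..d}"
  shows "dot_on (grid d P) u (on_line i l M \<star>\<^bsub>grid d P\<^esub> u) =
    dot_on (pts (P i)) (\<lambda>k. u (l(i := k))) (M \<star>\<^bsub>pts (P i)\<^esub> (\<lambda>k. u (l(i := k))))"
proof -
  note on = sum_grid_on_line[where l = l and i = i, OF line_upd[OF l i] i]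
  have inner: "(on_line i l M \<star>\<^bsub>grid d P\<^esub> u) x =
      (if x = l(i := x i) then (M \<star>\<^bsub>pts (P i)\<^esub> (\<lambda>k. u (l(i := k)))) (x i) else 0)" for x
  proof (cases "x = l(i := x i)")
    case True
    have "(on_line i l M \<star>\<^bsub>grid d P\<^esub> u) x =
        (\<Sum>y\<in>grid d P. if y = l(i := y i) then M (x i) (y i) * u y else 0)"
      unfolding mat_vec_def on_line_def using True by (intro sum.cong refl) auto
    also have "\<dots> = (M \<star>\<^bsub>pts (P i)\<^esub> (\<lambda>k. u (l(i := k)))) (x i)"
      by (subst on) (auto simp: mat_vec_def)
    finally show ?thesis using True by simp
  next
    case False
    then show ?thesis by (simp add: mat_vec_def on_line_def)
  qed
  have "dot_on (grid d P) u (on_line i l M \<star>\<^bsub>grid d P\<^esub> u) =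
      (\<Sum>x\<in>grid d P. if x = l(i := x i)
        then u x * (M \<star>\<^bsub>pts (P i)\<^esub> (\<lambda>k. u (l(i := k)))) (x i) else 0)"
    unfolding dot_on_def by (intro sum.cong refl) (simp add: inner)
  also have "\<dots> = dot_on (pts (P i)) (\<lambda>k. u (l(i := k))) (M \<star>\<^bsub>pts (P i)\<^esub> (\<lambda>k. u (l(i := k))))"
    by (subst on) (auto simp: dot_on_def)
  finally show ?thesis .
qed

lemma face_dir_eq: "face_dir f = (f + 1) div 2"
proof (cases "even f")
  case True
  then obtain k where "f = 2 * k" by blast
  then show ?thesis by (simp add: face_dir_def)
next
  case False
  then obtain k where f: "f = 2 * k + 1" by (auto elim: oddE)
  have "\<lceil>real f / 2\<rceil> = int k + 1"
    by (rule ceiling_unique) (auto simp: f field_simps)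
  then show ?thesis by (simp add: face_dir_def f)
qed

lemma face_dir_range: "f \<in> {1..2 * d} \<Longrightarrow> face_dir f \<in> {1..d}"
  by (auto simp: face_dir_eq)

text \<open>
  The elastic energy produces boundary terms direction by direction, the traction terms come face
  by face; this translates between the two.
\<close>
lemma sum_faces_by_direction:
  fixes d :: nat
  shows "(\<Sum>f\<in>{1..2 * d}. F f :: real) = (\<Sum>i\<in>{1..d}. F (2 * i - 1) + F (2 * i))"
  by (induction d) (auto simp: algebra_simps)

section \<open>The elastic energy on the block\<close>

definition grid_deriv :: "nat \<Rightarrow> (nat \<Rightarrow> sbp_op) \<Rightarrow> point rvec \<Rightarrow> nat \<Rightarrow> point \<Rightarrow> real" where
  "grid_deriv d P u i x = (Dt P i \<star>\<^bsub>grid d P\<^esub> u) x"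

definition face_mismatch :: "(nat \<Rightarrow> sbp_op) \<Rightarrow> point rvec \<Rightarrow> nat \<Rightarrow> point \<Rightarrow> real" where
  "face_mismatch P u f x =
     derivative_mismatch (P (face_dir f)) f (\<lambda>k. u (x(face_dir f := k)))"

definition face_coeff_min ::
    "(nat \<Rightarrow> sbp_op) \<Rightarrow> (nat \<Rightarrow> nat \<Rightarrow> point rvec) \<Rightarrow> nat \<Rightarrow> point \<Rightarrow> real" where
  "face_coeff_min P C f x =
     near_boundary_min (P (face_dir f)) f (\<lambda>k. C (face_dir f) (face_dir f) (x(face_dir f := k)))"

text \<open>
  Twice the elastic energy density at a grid point, computed from the \<open>D\<^sub>1\<close> derivatives.
\<close>
definition strain_form ::
    "nat \<Rightarrow> (nat \<Rightarrow> sbp_op) \<Rightarrow> (nat \<Rightarrow> nat \<Rightarrow> point rvec) \<Rightarrow> point rvec \<Rightarrow> point \<Rightarrow> real" where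
  "strain_form d P C u x =
     (\<Sum>i\<in>{1..d}. \<Sum>j\<in>{1..d}. C i j x * grid_deriv d P u i x * grid_deriv d P u j x)"

lemma tensor_diagonal:
  assumes "\<And>i. i \<in> J \<Longrightarrow> is_diagonal (pts (P i)) (Hm (P i))" "finite J"
    and "\<And>x i. x \<in> X \<Longrightarrow> i \<in> J \<Longrightarrow> x i \<in> pts (P i)"
    and "\<And>x y. x \<in> X \<Longrightarrow> y \<in> X \<Longrightarrow> x \<noteq> y \<Longrightarrow> \<exists>i\<in>J. x i \<noteq> y i"
  shows "is_diagonal X (tensor J (\<lambda>i. Hm (P i)))"
  unfolding is_diagonal_def
proof (intro ballI impI)
  fix x y assume xy: "x \<in> X" "y \<in> X" "x \<noteq> y"
  then obtain i where "i \<in> J" "x i \<noteq> y i" using assms(4) by blast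
  then have "Hm (P i) (x i) (y i) = 0"
    using xy assms(1)[of i] assms(3)[of _ i] by (auto simp: is_diagonal_def)
  then show "tensor J (\<lambda>i. Hm (P i)) x y = 0"
    using \<open>i \<in> J\<close> assms(2) by (auto simp: tensor_def intro!: prod_zero)
qed

lemma grid_points_differ:
  "x \<in> grid d P \<Longrightarrow> y \<in> grid d P \<Longrightarrow> x \<noteq> y \<Longrightarrow> \<exists>i\<in>{1..d}. x i \<noteq> y i"
  unfolding grid_def by (meson PiE_ext)

lemma Ht_diagonal:
  assumes "\<And>i. i \<in> {1..d} \<Longrightarrow> is_sbp_op (P i)"
  shows "is_diagonal (grid d P) (Ht d P)"
  unfolding Ht_def
  by (rule tensor_diagonal)
    (use assms grid_points_differ in \<open>blast intro: sbp_Hm_diagonal grid_coord\<close>)+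

lemma Hf_diagonal:
  assumes "\<And>i. i \<in> {1..d} \<Longrightarrow> is_sbp_op (P i)"
  shows "is_diagonal (face d P f) (Hf d P f)"
  unfolding Hf_def
proof (rule tensor_diagonal)
  fix x y assume "x \<in> face d P f" "y \<in> face d P f" "x \<noteq> y"
  then show "\<exists>i\<in>{1..d} - {face_dir f}. x i \<noteq> y i"
    using grid_points_differ[of x d P y] by (auto simp: face_def)
qed (use assms face_subset_grid in \<open>blast intro: sbp_Hm_diagonal grid_coord\<close>)+

lemma tensor_Hm_pos:
  assumes "\<And>i. i \<in> {1..d} \<Longrightarrow> is_sbp_op (P i)" "x \<in> grid d P" "J \<subseteq> {1..d}"
  shows "0 < tensor J (\<lambda>i. Hm (P i)) x x"
  unfolding tensor_def
  by (rule prod_pos) (use assms in \<open>auto intro!: sbp_Hm_pos grid_coord\<close>)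

lemma Ht_split:
  assumes "i \<in> {1..d}"
  shows "Ht d P x x = Hm (P i) (x i) (x i) * tensor ({1..d} - {i}) (\<lambda>i. Hm (P i)) x x"
  unfolding Ht_def tensor_def by (rule prod.remove) (use assms in auto)

lemma dot_At_offdiagonal:
  assumes "\<And>i. i \<in> {1..d} \<Longrightarrow> is_sbp_op (P i)" "i \<noteq> j"
  shows "dot_on (grid d P) u (At d P i j c \<star>\<^bsub>grid d P\<^esub> u) =
    (\<Sum>x\<in>grid d P. Ht d P x x * (c x * grid_deriv d P u i x * grid_deriv d P u j x))"
  using assms(2) unfolding At_def
  by (simp only: if_False dot_congruence_diagonal[OF finite_grid Ht_diagonal[OF assms(1)]])
    (simp add: grid_deriv_def algebra_simps)

lemma dot_At_diagonal:
  assumes "i \<in> {1..d}"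
  shows "dot_on (grid d P) u (At d P i i c \<star>\<^bsub>grid d P\<^esub> u) =
    (\<Sum>l\<in>lines d P i. tensor ({1..d} - {i}) (\<lambda>i. Hm (P i)) l l *
      dot_on (pts (P i)) (\<lambda>k. u (l(i := k)))
        (A11 (P i) (\<lambda>k. c (l(i := k))) \<star>\<^bsub>pts (P i)\<^esub> (\<lambda>k. u (l(i := k)))))"
proof -
  show ?thesis
    unfolding At_def
    by (simp add: dot_mat_vec_sum mat_vec_scale_mat dot_on_scale)
      (intro sum.cong refl, simp add: dot_on_line[OF _ assms] tensor_def)
qed

text \<open>
  The one-dimensional bound is summed over the grid lines with their weights.  The volume parts
  recombine to the full grid quadrature, since the line weight times the entry of \<open>H\<close> along
  the line is the grid weight.  The endpoints of the lines run through the two faces normal to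
  \<open>i\<close>, whose quadrature weight is the line weight itself.
\<close>
lemma dot_At_diagonal_lower_bound:
  assumes sbp: "\<And>i. i \<in> {1..d} \<Longrightarrow> is_sbp_op (P i)" and i: "i \<in> {1..d}"
    and pos: "\<And>x. x \<in> grid d P \<Longrightarrow> 0 < C i i x"
  shows "(\<Sum>x\<in>grid d P. Ht d P x x * (C i i x * grid_deriv d P u i x * grid_deriv d P u i x)) +
      (\<Sum>f\<in>{2 * i - 1, 2 * i}. \<Sum>x\<in>face d P f.
         Hf d P f x x * (zeta (P (face_dir f)) * face_coeff_min P C f x * (face_mismatch P u f x)\<^sup>2))
    \<le> dot_on (grid d P) u (At d P i i (C i i) \<star>\<^bsub>grid d P\<^esub> u)"
proof -
  let ?w = "\<lambda>l. tensor ({1..d} - {i}) (\<lambda>i. Hm (P i)) l l"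
  let ?u = "\<lambda>l k. u (l(i := k))" and ?c = "\<lambda>l k. C i i (l(i := k))"
  have w_upd: "?w (l(i := k)) = ?w l" for l k
    unfolding tensor_def by (intro prod.cong) auto
  have fd: "face_dir (2 * i - 1) = i" "face_dir (2 * i) = i" "odd (2 * i - 1)" "2 * i - 1 \<noteq> 2 * i"
    using i by (auto simp: face_dir_eq)
  have volume: "(\<Sum>x\<in>grid d P. Ht d P x x * (C i i x * grid_deriv d P u i x * grid_deriv d P u i x)) =
      (\<Sum>l\<in>lines d P i. ?w l *
        (\<Sum>k\<in>pts (P i). ?c l k * Hm (P i) k k * ((D1 (P i) \<star>\<^bsub>pts (P i)\<^esub> ?u l) k)\<^sup>2))"
    unfolding sum_grid_by_lines[OF i] sum_distrib_left
    by (intro sum.cong refl)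
      (simp add: Ht_split[OF i] w_upd grid_deriv_def Dt_def along_apply[OF line_upd[OF _ i] i]
        power2_eq_square del: One_nat_def)
  have boundary: "(\<Sum>x\<in>face d P f.
         Hf d P f x x * (zeta (P (face_dir f)) * face_coeff_min P C f x * (face_mismatch P u f x)\<^sup>2)) =
      (\<Sum>l\<in>lines d P i. ?w l * (zeta (P i) * near_boundary_min (P i) f (?c l) *
         (derivative_mismatch (P i) f (?u l))\<^sup>2))" if "face_dir f = i" for f
    by (simp add: sum_face_by_lines[OF that i] that Hf_def w_upd face_coeff_min_def
        face_mismatch_def del: One_nat_def)
  have parity: "near_boundary_min Q (2 * i - 1) c = near_boundary_min Q 1 c"
      "near_boundary_min Q (2 * i) c = near_boundary_min Q 2 c"
      "derivative_mismatch Q (2 * i - 1) v = derivative_mismatch Q 1 v"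
      "derivative_mismatch Q (2 * i) v = derivative_mismatch Q 2 v" for Q c v
    using fd(3) by (simp_all add: near_boundary_min_def derivative_mismatch_def
        boundary_index_def boundary_derivative_def)
  have pair: "(\<Sum>f\<in>{2 * i - 1, 2 * i}. G f) = G (2 * i - 1) + G (2 * i)" for G :: "nat \<Rightarrow> real"
    using fd(4) by simp
  have distribute: "w * (a + z * (b1 * m1 + b2 * m2)) =
      w * a + (w * (z * b1 * m1) + w * (z * b2 * m2))" for w a z b1 b2 m1 m2 :: real
    by (simp add: algebra_simps)
  have "(\<Sum>l\<in>lines d P i. ?w l *
      ((\<Sum>k\<in>pts (P i). ?c l k * Hm (P i) k k * ((D1 (P i) \<star>\<^bsub>pts (P i)\<^esub> ?u l) k)\<^sup>2) +
       zeta (P i) * (near_boundary_min (P i) 1 (?c l) * (derivative_mismatch (P i) 1 (?u l))\<^sup>2 +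
                near_boundary_min (P i) 2 (?c l) * (derivative_mismatch (P i) 2 (?u l))\<^sup>2)))
     \<le> (\<Sum>l\<in>lines d P i. ?w l * dot_on (pts (P i)) (?u l) (A11 (P i) (?c l) \<star>\<^bsub>pts (P i)\<^esub> ?u l))"
  proof (rule sum_mono)
    fix l assume l: "l \<in> lines d P i"
    \<comment> \<open>The weight ignores coordinate \<open>i\<close>, so the line may be replaced by any of its points.\<close>
    have "?w (l(i := 0)) > 0"
      by (rule tensor_Hm_pos[of d]) (use sbp i l in \<open>auto intro!: line_upd simp: pts_def\<close>)
    then have "0 \<le> ?w l" by (simp only: w_upd)
    then show "?w l *
      ((\<Sum>k\<in>pts (P i). ?c l k * Hm (P i) k k * ((D1 (P i) \<star>\<^bsub>pts (P i)\<^esub> ?u l) k)\<^sup>2) +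
       zeta (P i) * (near_boundary_min (P i) 1 (?c l) * (derivative_mismatch (P i) 1 (?u l))\<^sup>2 +
                near_boundary_min (P i) 2 (?c l) * (derivative_mismatch (P i) 2 (?u l))\<^sup>2))
      \<le> ?w l * dot_on (pts (P i)) (?u l) (A11 (P i) (?c l) \<star>\<^bsub>pts (P i)\<^esub> ?u l)"
      by (intro mult_left_mono sbp_energy_lower_bound sbp i pos line_upd[OF l i])
  qed
  then show ?thesis
    unfolding distribute sum.distrib dot_At_diagonal[OF i] volume pair
      boundary[OF fd(1)] boundary[OF fd(2)] parity .
qed

text \<open>
  The mixed terms \<open>i \<noteq> j\<close> are exact and complete the diagonal volume terms to the strain
  form.  What is left over are the borrowed boundary terms, one for each face.
\<close>
lemma elastic_energy_lower_bound:
  assumes sbp: "\<And>i. i \<in> {1..d} \<Longrightarrow> is_sbp_op (P i)"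
    and pos: "\<And>i x. i \<in> {1..d} \<Longrightarrow> x \<in> grid d P \<Longrightarrow> 0 < C i i x"
  shows "(\<Sum>x\<in>grid d P. Ht d P x x * strain_form d P C u x) +
      (\<Sum>f\<in>{1..2 * d}. \<Sum>x\<in>face d P f. Hf d P f x x *
         (zeta (P (face_dir f)) * face_coeff_min P C f x * (face_mismatch P u f x)\<^sup>2))
    \<le> (\<Sum>i\<in>{1..d}. \<Sum>j\<in>{1..d}. dot_on (grid d P) u (At d P i j (C i j) \<star>\<^bsub>grid d P\<^esub> u))"
proof -
  let ?V = "\<lambda>i j. \<Sum>x\<in>grid d P.
    Ht d P x x * (C i j x * grid_deriv d P u i x * grid_deriv d P u j x)"
  let ?B = "\<lambda>f. \<Sum>x\<in>face d P f. Hf d P f x x *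
    (zeta (P (face_dir f)) * face_coeff_min P C f x * (face_mismatch P u f x)\<^sup>2)"
  let ?E = "\<lambda>i j. dot_on (grid d P) u (At d P i j (C i j) \<star>\<^bsub>grid d P\<^esub> u)"
  have row: "(\<Sum>j\<in>{1..d}. ?V i j) + (?B (2 * i - 1) + ?B (2 * i)) \<le> (\<Sum>j\<in>{1..d}. ?E i j)"
    if i: "i \<in> {1..d}" for i
  proof -
    have "2 * i - 1 \<noteq> 2 * i" using i by auto
    then have pair: "(\<Sum>f\<in>{2 * i - 1, 2 * i}. G f) = G (2 * i - 1) + G (2 * i)"
      for G :: "nat \<Rightarrow> real" by simp
    have "?V i i + (?B (2 * i - 1) + ?B (2 * i)) \<le> ?E i i"
      using dot_At_diagonal_lower_bound[where C = C and u = u and P = P, OF sbp i pos[OF i]]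
      unfolding pair .
    moreover have "(\<Sum>j\<in>{1..d} - {i}. ?V i j) = (\<Sum>j\<in>{1..d} - {i}. ?E i j)"
      by (intro sum.cong refl dot_At_offdiagonal[OF sbp, symmetric]) auto
    ultimately show ?thesis
      unfolding sum.remove[OF finite_atLeastAtMost i] by linarith
  qed
  have "(\<Sum>x\<in>grid d P. Ht d P x x * strain_form d P C u x) = (\<Sum>i\<in>{1..d}. \<Sum>j\<in>{1..d}. ?V i j)"
    unfolding strain_form_def sum_distrib_left
    by (subst sum.swap, intro sum.cong refl, subst sum.swap) simp
  then show ?thesis
    using sum_mono[OF row] by (simp only: sum_faces_by_direction sum.distrib)
qed

section \<open>Tractions and penalties on a face\<close>

text \<open>
  All tangential derivatives in the traction are \<open>D\<^sub>1\<close> derivatives of the grid.  Only the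
  normal one uses the boundary derivative vector, and replacing it by \<open>D\<^sub>1\<close> costs the
  mismatch term.
\<close>
lemma Tf_apply:
  assumes f: "f \<in> {1..2 * d}" and x: "x \<in> face d P f"
  shows "Tf d P C u f x = (-1) ^ f *
    ((\<Sum>j\<in>{1..d}. C (face_dir f) j x * grid_deriv d P u j x) +
     C (face_dir f) (face_dir f) x * face_mismatch P u f x)"
proof -
  let ?i = "face_dir f"
  have i: "?i \<in> {1..d}" by (rule face_dir_range[OF f])
  have xg: "x \<in> grid d P" and xi: "x ?i = boundary_index (P ?i) f"
    using x by (auto simp: face_def boundary_index_def)
  have B: "(Bf d P f j \<star>\<^bsub>grid d P\<^esub> u) x =
      grid_deriv d P u j x + (if j = ?i then face_mismatch P u f x else 0)"
    if j: "j \<in> {1..d}" for j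
  proof (cases "j = ?i")
    case True
    have "(Bf d P f ?i \<star>\<^bsub>grid d P\<^esub> u) x =
        dot_on (pts (P ?i)) (boundary_derivative (P ?i) f) (\<lambda>k. u (x(?i := k)))"
      unfolding Bf_def
      by (simp only: refl if_True along_apply[OF xg i])
        (simp add: boundary_derivative_def dot_on_def mat_vec_def)
    then show ?thesis
      using True xi
      by (simp add: face_mismatch_def derivative_mismatch_def grid_deriv_def Dt_def
          along_apply[OF xg i])
  next
    case False
    have dg: "is_diagonal (grid d P) Lf" by (simp add: is_diagonal_def Lf_def)
    have "(Lf \<cdot>\<^bsub>grid d P\<^esub> Dt P j) x y = Dt P j x y" for y
      by (simp add: mat_mul_diagonal[OF _ dg xg]) (simp add: Lf_def)
    then show ?thesis
      using False by (simp add: Bf_def grid_deriv_def mat_vec_def)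
  qed
  have D: "(diag_mat (C i' j) \<star>\<^bsub>face d P f\<^esub> w) x = C i' j x * w x" for i' j w
    by (simp add: mat_vec_diagonal[OF _ is_diagonal_diag_mat x]) (simp add: diag_mat_def)
  have "Tf d P C u f x = (\<Sum>i'\<in>{1..d}. \<Sum>j\<in>{1..d}.
      normal f i' * (C i' j x * (Bf d P f j \<star>\<^bsub>grid d P\<^esub> u) x))"
    unfolding Tf_def by (simp add: sum_vector_apply scale_vec_def D)
  also have "\<dots> = (\<Sum>j\<in>{1..d}. (-1) ^ f * (C ?i j x * (Bf d P f j \<star>\<^bsub>grid d P\<^esub> u) x))"
    by (subst sum_only_one[of _ ?i]) (use i in \<open>auto simp: normal_def\<close>)
  also have "\<dots> = (\<Sum>j\<in>{1..d}. (-1) ^ f * (C ?i j x * grid_deriv d P u j x)) +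
      (\<Sum>j\<in>{1..d}. if j = ?i then (-1) ^ f * (C ?i j x * face_mismatch P u f x) else 0)"
    unfolding sum.distrib[symmetric] by (intro sum.cong refl) (auto simp: B algebra_simps)
  also have "\<dots> = (-1) ^ f * ((\<Sum>j\<in>{1..d}. C ?i j x * grid_deriv d P u j x) +
      C ?i ?i x * face_mismatch P u f x)"
    using i by (simp add: sum_distrib_left distrib_left)
  finally show ?thesis .
qed

lemma Xf_apply:
  assumes f: "f \<in> {1..2 * d}" and x: "x \<in> face d P f"
  shows "Xf d P C \<gamma> f x y = (if x = y then C (face_dir f) (face_dir f) x * \<gamma> f x else 0)"
proof -
  let ?i = "face_dir f"
  have i: "?i \<in> {1..d}" by (rule face_dir_range[OF f])
  have M: "(diag_mat (C i' j) \<cdot>\<^bsub>face d P f\<^esub> diag_mat (\<gamma> f)) x y =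
      C i' j x * diag_mat (\<gamma> f) x y" for i' j
    by (simp add: mat_mul_diagonal[OF _ is_diagonal_diag_mat x])
      (simp add: diag_mat_def)
  have "Xf d P C \<gamma> f x y = (\<Sum>i'\<in>{1..d}. \<Sum>j\<in>{1..d}.
      normal f i' * normal f j * (C i' j x * diag_mat (\<gamma> f) x y))"
    unfolding Xf_def by (simp add: sum_matrix_apply scale_mat_def M)
  also have "\<dots> = C ?i ?i x * diag_mat (\<gamma> f) x y"
    by (subst sum_only_one[of _ ?i], (use i in \<open>auto simp: normal_def\<close>)[3],
        subst sum_only_one[of _ ?i])
      (use i in \<open>auto simp: normal_def simp flip: power_add mult_2\<close>)
  finally show ?thesis by (simp add: diag_mat_def)
qed

text \<open>
  At a face point, \<open>c\<close> is the normal coefficient \<open>C\<^sub>i\<^sub>i\<close>, \<open>h\<close> the normal entry of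
  \<open>H\<close>, \<open>z\<close> the borrowed amount \<open>\<zeta> C\<^sup>m\<^sup>i\<^sup>n\<close> and \<open>2 D\<close> the number of faces.  By
  \<open>(a + b)\<^sup>2 \<le> 2 a\<^sup>2 + 2 b\<^sup>2\<close> the traction term is at most
  \<open>(2/\<gamma>) q + (2 c/\<gamma>) \<delta>\<^sup>2\<close>.  The two summands of the lower bound on \<open>\<gamma>\<close> are exactly
  what keeps these coefficients below or equal to \<open>h/(2 D)\<close> and \<open>z\<close>.
\<close>
lemma traction_pointwise_bound:
  fixes c q s \<delta> h z \<gamma> D :: real
  assumes "0 < c" "0 < h" "0 < z" "0 < D" "0 \<le> q" "s\<^sup>2 \<le> c * q"
    and \<gamma>: "4 * D / h + 2 * c / z \<le> \<gamma>"
  shows "(s + c * \<delta>)\<^sup>2 / (c * \<gamma>) \<le> h * q / (2 * D) + z * \<delta>\<^sup>2"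
proof -
  have a: "0 < 4 * D / h" "0 < 2 * c / z" using assms by auto
  then have g: "0 < \<gamma>" using \<gamma> by linarith
  have "4 * D / h \<le> \<gamma>" "2 * c / z \<le> \<gamma>" using a \<gamma> by linarith+
  then have "2 / \<gamma> \<le> h / (2 * D)" "2 * c / \<gamma> \<le> z"
    using assms g by (auto simp: field_simps)
  then have "2 / \<gamma> * q \<le> h / (2 * D) * q" "2 * c / \<gamma> * \<delta>\<^sup>2 \<le> z * \<delta>\<^sup>2"
    using assms(5) by (intro mult_right_mono; simp)+
  moreover have "(s + c * \<delta>)\<^sup>2 / (c * \<gamma>) \<le> (2 * (c * q) + 2 * (c * \<delta>)\<^sup>2) / (c * \<gamma>)"
  proof (rule divide_right_mono)
    have "0 \<le> (s - c * \<delta>)\<^sup>2" by simp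
    then show "(s + c * \<delta>)\<^sup>2 \<le> 2 * (c * q) + 2 * (c * \<delta>)\<^sup>2"
      using assms(6) by (simp add: power2_eq_square algebra_simps)
  qed (use assms g in auto)
  moreover have "(2 * (c * q) + 2 * (c * \<delta>)\<^sup>2) / (c * \<gamma>) = 2 / \<gamma> * q + 2 * c / \<gamma> * \<delta>\<^sup>2"
    using assms g by (simp add: power2_eq_square field_simps)
  ultimately show ?thesis by simp
qed

text \<open>
  The lower bound on \<open>\<gamma>\<close> of the previous lemma at a point of face \<open>f\<close>.
\<close>
definition penalty_bound ::
    "nat \<Rightarrow> (nat \<Rightarrow> sbp_op) \<Rightarrow> (nat \<Rightarrow> nat \<Rightarrow> point rvec) \<Rightarrow> nat \<Rightarrow> point \<Rightarrow> real" where
  "penalty_bound d P C f x =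
     4 * real d / Hm (P (face_dir f)) (x (face_dir f)) (x (face_dir f)) +
     2 * C (face_dir f) (face_dir f) x / (zeta (P (face_dir f)) * face_coeff_min P C f x)"

lemma strain_form_eq_dot:
  "strain_form d P C u x = dot_on {1..d} (\<lambda>i. grid_deriv d P u i x)
     ((\<lambda>i j. C i j x) \<star>\<^bsub>{1..d}\<^esub> (\<lambda>i. grid_deriv d P u i x))"
  unfolding strain_form_def dot_on_def mat_vec_def sum_distrib_left
  by (intro sum.cong refl) (simp only: mult_ac)

lemma half_sum_nonneg:
  fixes k e p t :: real
  assumes "0 \<le> k" "0 \<le> p" "t \<le> e"
  shows "0 \<le> 1/2 * k + 1/2 * e + 1/2 * (p - t)"
  unfolding right_diff_distrib using assms by linarith

theorem theorem7:
  fixes d :: nat and P :: "nat \<Rightarrow> sbp_op"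
    and C :: "nat \<Rightarrow> nat \<Rightarrow> point rvec" and \<rho> :: "point rvec"
  assumes "1 \<le> d"
    and "\<And>i. i \<in> {1..d} \<Longrightarrow> is_sbp_op (P i)"
    and "\<And>x. x \<in> grid d P \<Longrightarrow> sym_mat {1..d} (\<lambda>i j. C i j x)"
    and "\<And>x. x \<in> grid d P \<Longrightarrow> pos_def_mat {1..d} (\<lambda>i j. C i j x)"
    and "\<And>x. x \<in> grid d P \<Longrightarrow> 0 < \<rho> x"
  shows "\<exists>\<gamma>\<^sub>0>0. \<forall>\<gamma> :: nat \<Rightarrow> point rvec.
           (\<forall>f\<in>{1..2 * d}. \<forall>x\<in>face d P f. \<gamma>\<^sub>0 < \<gamma> f x) \<longrightarrow>
           (\<forall>u v us. 0 \<le> block_energy d P C \<rho> \<gamma> u v us)"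
proof -
  note sbp = assms(2)
  have Cpos: "0 < C i i x" if "i \<in> {1..d}" "x \<in> grid d P" for i x
    using pos_def_diagonal_entry[OF _ assms(4)[OF that(2)] that(1)] by simp
  have Hpos: "0 < Ht d P x x" "0 < Hf d P f x x" if "x \<in> grid d P" for x f
    unfolding Ht_def Hf_def by (rule tensor_Hm_pos[OF sbp that]; auto)+
  have strain_nonneg: "0 \<le> strain_form d P C u x" if "x \<in> grid d P" for x u
    unfolding strain_form_eq_dot by (rule pos_def_form_nonneg[OF assms(4)[OF that]])
  have face_pos: "0 < Hm (P (face_dir f)) (x (face_dir f)) (x (face_dir f))"
      "0 < zeta (P (face_dir f)) * face_coeff_min P C f x"
      "0 < C (face_dir f) (face_dir f) x"
    if f: "f \<in> {1..2 * d}" and x: "x \<in> face d P f" for f x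
  proof -
    have i: "face_dir f \<in> {1..d}" by (rule face_dir_range[OF f])
    have xg: "x \<in> grid d P" using x face_subset_grid by blast
    show "0 < Hm (P (face_dir f)) (x (face_dir f)) (x (face_dir f))"
      by (rule sbp_Hm_pos[OF sbp[OF i] grid_coord[OF xg i]])
    show "0 < zeta (P (face_dir f)) * face_coeff_min P C f x"
      unfolding face_coeff_min_def
      by (intro mult_pos_pos zeta_pos near_boundary_min_pos sbp i Cpos grid_upd[OF xg i])
    show "0 < C (face_dir f) (face_dir f) x" by (rule Cpos[OF i xg])
  qed
  \<comment> \<open>The sum serves as a common upper bound of the finitely many nonnegative pointwise bounds.\<close>
  define \<gamma>\<^sub>0 where "\<gamma>\<^sub>0 = 1 + (\<Sum>f\<in>{1..2 * d}. \<Sum>x\<in>face d P f. penalty_bound d P C f x)"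
  have bound_nonneg: "0 \<le> penalty_bound d P C f x"
    if "f \<in> {1..2 * d}" "x \<in> face d P f" for f x
    unfolding penalty_bound_def using face_pos[OF that] by (intro add_nonneg_nonneg) auto
  have \<gamma>\<^sub>0_pos: "0 < \<gamma>\<^sub>0"
    unfolding \<gamma>\<^sub>0_def by (intro add_pos_nonneg sum_nonneg bound_nonneg) auto
  have bound_le: "penalty_bound d P C f x \<le> \<gamma>\<^sub>0" if "f \<in> {1..2 * d}" "x \<in> face d P f" for f x
  proof -
    have "penalty_bound d P C f x \<le> (\<Sum>x\<in>face d P f. penalty_bound d P C f x)"
      by (rule member_le_sum) (use that bound_nonneg in auto)
    also have "\<dots> \<le> (\<Sum>f\<in>{1..2 * d}. \<Sum>x\<in>face d P f. penalty_bound d P C f x)"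
      by (rule member_le_sum[where f = "\<lambda>f. \<Sum>x\<in>face d P f. penalty_bound d P C f x"])
        (use that bound_nonneg in \<open>auto intro!: sum_nonneg\<close>)
    finally show ?thesis by (simp add: \<gamma>\<^sub>0_def)
  qed
  show ?thesis
  proof (intro exI[of _ \<gamma>\<^sub>0] conjI allI impI)
    fix \<gamma> :: "nat \<Rightarrow> point rvec" and u v us
    assume \<gamma>: "\<forall>f\<in>{1..2 * d}. \<forall>x\<in>face d P f. \<gamma>\<^sub>0 < \<gamma> f x"
    have face_form: "dot_on (face d P f) t (mat_inv (face d P f) (Xf d P C \<gamma> f) \<star>\<^bsub>face d P f\<^esub>
          Hf d P f \<star>\<^bsub>face d P f\<^esub> t) =
        (\<Sum>x\<in>face d P f. Hf d P f x x * (t x)\<^sup>2 / (C (face_dir f) (face_dir f) x * \<gamma> f x))"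
      if f: "f \<in> {1..2 * d}" for f t
    proof -
      have dg: "is_diagonal (face d P f) (Xf d P C \<gamma> f)"
        using f by (auto simp: is_diagonal_def Xf_apply)
      have nz: "Xf d P C \<gamma> f x x \<noteq> 0" if "x \<in> face d P f" for x
        using face_pos(3)[OF f that] \<gamma> f that \<gamma>\<^sub>0_pos by (force simp: Xf_apply)
      have "dot_on (face d P f) t (mat_inv (face d P f) (Xf d P C \<gamma> f) \<star>\<^bsub>face d P f\<^esub>
            Hf d P f \<star>\<^bsub>face d P f\<^esub> t) =
          (\<Sum>x\<in>face d P f. Hf d P f x x * (t x)\<^sup>2 / Xf d P C \<gamma> f x x)"
        by (rule dot_mat_inv_diagonal[OF finite_face dg Hf_diagonal[OF sbp] nz])
      then show ?thesis by (simp add: Xf_apply[OF f])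
    qed
    have Ht_diag: "is_diagonal (grid d P) (Ht d P)" by (rule Ht_diagonal[OF sbp])
    have kinetic: "0 \<le> dot_on (grid d P) v (Ht d P \<star>\<^bsub>grid d P\<^esub> diag_mat \<rho> \<star>\<^bsub>grid d P\<^esub> v)"
      unfolding dot_on_def
    proof (rule sum_nonneg)
      fix x assume x: "x \<in> grid d P"
      have "v x * (Ht d P \<star>\<^bsub>grid d P\<^esub> diag_mat \<rho> \<star>\<^bsub>grid d P\<^esub> v) x = Ht d P x x * \<rho> x * (v x)\<^sup>2"
        by (simp add: mat_vec_diagonal[OF finite_grid Ht_diag x]
            mat_vec_diagonal[OF finite_grid is_diagonal_diag_mat x])
          (simp add: diag_mat_def power2_eq_square)
      then show "0 \<le> v x * (Ht d P \<star>\<^bsub>grid d P\<^esub> diag_mat \<rho> \<star>\<^bsub>grid d P\<^esub> v) x"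
        using Hpos(1)[OF x] assms(5)[OF x] by simp
    qed
    have penalty: "0 \<le> dot_on (face d P f) (tauf d P C \<gamma> u us f)
        (mat_inv (face d P f) (Xf d P C \<gamma> f) \<star>\<^bsub>face d P f\<^esub>
           Hf d P f \<star>\<^bsub>face d P f\<^esub> tauf d P C \<gamma> u us f)" if f: "f \<in> {1..2 * d}" for f
      unfolding face_form[OF f]
    proof (rule sum_nonneg)
      fix x assume x: "x \<in> face d P f"
      have "0 < \<gamma> f x" using \<gamma> f x \<gamma>\<^sub>0_pos by force
      moreover have "x \<in> grid d P" using x face_subset_grid by blast
      ultimately show "0 \<le> Hf d P f x x * (tauf d P C \<gamma> u us f x)\<^sup>2 /
          (C (face_dir f) (face_dir f) x * \<gamma> f x)"
        using face_pos(3)[OF f x] Hpos(2)[of x f] by simp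
    qed
    let ?G = "\<lambda>x. Ht d P x x * strain_form d P C u x"
    let ?M = "\<lambda>f x. Hf d P f x x *
      (zeta (P (face_dir f)) * face_coeff_min P C f x * (face_mismatch P u f x)\<^sup>2)"
    have traction: "dot_on (face d P f) (Tf d P C u f)
        (mat_inv (face d P f) (Xf d P C \<gamma> f) \<star>\<^bsub>face d P f\<^esub>
           Hf d P f \<star>\<^bsub>face d P f\<^esub> Tf d P C u f)
      \<le> (\<Sum>x\<in>grid d P. ?G x) / (2 * real d) + (\<Sum>x\<in>face d P f. ?M f x)"
      if f: "f \<in> {1..2 * d}" for f
    proof -
      have i: "face_dir f \<in> {1..d}" by (rule face_dir_range[OF f])
      have "(\<Sum>x\<in>face d P f. Hf d P f x x * (Tf d P C u f x)\<^sup>2 /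
            (C (face_dir f) (face_dir f) x * \<gamma> f x))
          \<le> (\<Sum>x\<in>face d P f. ?G x / (2 * real d) + ?M f x)"
      proof (rule sum_mono)
        fix x assume x: "x \<in> face d P f"
        have xg: "x \<in> grid d P" using x face_subset_grid by blast
        let ?s = "\<Sum>j\<in>{1..d}. C (face_dir f) j x * grid_deriv d P u j x"
        let ?c = "C (face_dir f) (face_dir f) x" and ?\<delta> = "face_mismatch P u f x"
        let ?h = "Hm (P (face_dir f)) (x (face_dir f)) (x (face_dir f))"
        let ?z = "zeta (P (face_dir f)) * face_coeff_min P C f x"
        have "?s\<^sup>2 \<le> ?c * strain_form d P C u x"
          using row_cauchy_schwarz[OF _ assms(3)[OF xg] assms(4)[OF xg] i,
              of "\<lambda>i. grid_deriv d P u i x"]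
          by (simp add: strain_form_eq_dot) (simp add: mat_vec_def)
        moreover have "4 * real d / ?h + 2 * ?c / ?z \<le> \<gamma> f x"
          using bound_le[OF f x] \<gamma> f x unfolding penalty_bound_def by force
        ultimately have "(?s + ?c * ?\<delta>)\<^sup>2 / (?c * \<gamma> f x) \<le>
            ?h * strain_form d P C u x / (2 * real d) + ?z * ?\<delta>\<^sup>2"
          by (intro traction_pointwise_bound strain_nonneg face_pos[OF f x] xg)
            (use assms(1) in auto)
        moreover have "(Tf d P C u f x)\<^sup>2 = (?s + ?c * ?\<delta>)\<^sup>2"
          unfolding Tf_apply[OF f x] by (simp add: power_mult_distrib flip: power_mult)
        ultimately have "Hf d P f x x * ((Tf d P C u f x)\<^sup>2 / (?c * \<gamma> f x)) \<le> Hf d P f x x *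
            (?h * strain_form d P C u x / (2 * real d) + ?z * ?\<delta>\<^sup>2)"
          using Hpos(2)[OF xg, of f] by (intro mult_left_mono) auto
        then show "Hf d P f x x * (Tf d P C u f x)\<^sup>2 / (?c * \<gamma> f x) \<le> ?G x / (2 * real d) + ?M f x"
          using Ht_split[OF i, of P x] by (simp add: Hf_def algebra_simps)
      qed
      also have "\<dots> = (\<Sum>x\<in>face d P f. ?G x) / (2 * real d) + (\<Sum>x\<in>face d P f. ?M f x)"
        by (simp add: sum.distrib sum_divide_distrib)
      \<comment> \<open>Faces overlap, so each of them draws only its share \<open>1/(2 d)\<close> of the grid sum.\<close>
      also have "(\<Sum>x\<in>face d P f. ?G x) \<le> (\<Sum>x\<in>grid d P. ?G x)"
        by (rule sum_mono2) (use face_subset_grid Hpos(1) strain_nonneg in \<open>auto simp: less_imp_le\<close>)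
      finally show ?thesis
        unfolding face_form[OF f] by (simp add: divide_right_mono)
    qed
    have penalties: "0 \<le> (\<Sum>f\<in>{1..2 * d}. dot_on (face d P f) (tauf d P C \<gamma> u us f)
        (mat_inv (face d P f) (Xf d P C \<gamma> f) \<star>\<^bsub>face d P f\<^esub>
           Hf d P f \<star>\<^bsub>face d P f\<^esub> tauf d P C \<gamma> u us f))"
      by (intro sum_nonneg penalty)
    have "(\<Sum>f\<in>{1..2 * d}. dot_on (face d P f) (Tf d P C u f)
        (mat_inv (face d P f) (Xf d P C \<gamma> f) \<star>\<^bsub>face d P f\<^esub>
           Hf d P f \<star>\<^bsub>face d P f\<^esub> Tf d P C u f))
      \<le> (\<Sum>f\<in>{1..2 * d}. (\<Sum>x\<in>grid d P. ?G x) / (2 * real d) + (\<Sum>x\<in>face d P f. ?M f x))"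
      by (intro sum_mono traction)
    also have "(\<Sum>f\<in>{1..2 * d}. (\<Sum>x\<in>grid d P. ?G x) / (2 * real d) + (\<Sum>x\<in>face d P f. ?M f x)) =
        (\<Sum>x\<in>grid d P. ?G x) + (\<Sum>f\<in>{1..2 * d}. \<Sum>x\<in>face d P f. ?M f x)"
      using assms(1) by (simp add: sum.distrib)
    also have "\<dots> \<le> (\<Sum>i\<in>{1..d}. \<Sum>j\<in>{1..d}.
        dot_on (grid d P) u (At d P i j (C i j) \<star>\<^bsub>grid d P\<^esub> u))"
      by (rule elastic_energy_lower_bound[OF sbp Cpos])
    finally have tractions: "(\<Sum>f\<in>{1..2 * d}. dot_on (face d P f) (Tf d P C u f)
        (mat_inv (face d P f) (Xf d P C \<gamma> f) \<star>\<^bsub>face d P f\<^esub>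
           Hf d P f \<star>\<^bsub>face d P f\<^esub> Tf d P C u f))
      \<le> (\<Sum>i\<in>{1..d}. \<Sum>j\<in>{1..d}.
        dot_on (grid d P) u (At d P i j (C i j) \<star>\<^bsub>grid d P\<^esub> u))" .
    show "0 \<le> block_energy d P C \<rho> \<gamma> u v us"
      unfolding block_energy_def sum_subtractf by (rule half_sum_nonneg[OF kinetic penalties tractions])
  qed (rule \<gamma>\<^sub>0_pos)
qed

end
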